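(* The downlink upper capacity bound $${\tt C}^{\mathrm{DL}}_{\mathrm{upper}}=\frac{T^{\mathrm{DL}}_{\mathrm{data}}}{T_{\mathrm{coher}}}\log_2\left(1+\frac{G^{\mathrm{DL}}}{1+\kappa_r^{\mathrm{UE}}G^{\mathrm{DL}}}\right),\quad G^{\mathrm{DL}}=\sum_{i=1}^N\frac{1}{\kappa_t^{\mathrm{BS}}}\left(1-\frac{\sigma_{\mathrm{UE}}^2}{p^{\mathrm{BS}}\kappa_t^{\mathrm{BS}}r_{ii}}e^{\frac{\sigma_{\mathrm{UE}}^2}{p^{\mathrm{BS}}\kappa_t^{\mathrm{BS}}r_{ii}}}E_1\!\left(\frac{\sigma_{\mathrm{UE}}^2}{p^{\mathrm{BS}}\kappa_t^{\mathrm{BS}}r_{ii}}\right)\right)$$ has the asymptotic properties $$\lim_{p^{\mathrm{BS}}\to\infty}{\tt C}^{\mathrm{DL}}_{\mathrm{upper}}=\frac{T^{\mathrm{DL}}_{\mathrm{data}}}{T_{\mathrm{coher}}}\log_2\left(1+\frac{N}{\kappa_t^{\mathrm{BS}}+\kappa_r^{\mathrm{UE}}N}\right),\qquad \lim_{N\to\infty}{\tt C}^{\mathrm{DL}}_{\mathrm{upper}}=\frac{T^{\mathrm{DL}}_{\mathrm{data}}}{T_{\mathrm{coher}}}\log_2\left(1+\frac{1}{\kappa_r^{\mathrm{UE}}}\right),$$ where $N$ is fixed in the first limit and all other parameters are fixed in the second.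
   Context: $N$ is the number of base station antennas, $r_{11},\dots,r_{NN}$ are the diagonal elements of the channel covariance matrix $\mathbf R\in\mathbb C^{N\times N}$ (positive semi-definite, depending on $N$), $p^{\mathrm{BS}}>0$ is the downlink transmit power, $\sigma_{\mathrm{UE}}^2>0$ the receiver noise variance at the user, $\kappa_t^{\mathrm{BS}},\kappa_r^{\mathrm{UE}}>0$ the levels of hardware impairments of the BS transmitter and the user receiver, and $T^{\mathrm{DL}}_{\mathrm{data}}/T_{\mathrm{coher}}$ the fraction of channel uses for downlink data. $E_1(x)=\int_1^\infty\frac{e^{-tx}}{t}dt$. Standing assumptions on $\mathbf R$: $r_{ii}>0$ for all $i$; $\|\mathbf R\|_2=\mathcal O(1)$ as $N\to\infty$; $0<\liminf_N\frac1N\mathrm{tr}(\mathbf R)\le\limsup_N\frac1N\mathrm{tr}(\mathbf R)<\infty$. *)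

theory Defs
  imports
    "HOL-Analysis.Analysis"
    "HOL-Library.Landau_Symbols"
    "Jordan_Normal_Form.Schur_Decomposition"
begin

unbundle no vec_syntax

text \<open>\<^term>\<open>(A *\<^sub>v v) \<bullet>c v\<close> is \<open>v\<^sup>H A v\<close>.\<close>

definition pos_semidef :: "complex mat \<Rightarrow> bool" where
  "pos_semidef A \<longleftrightarrow>
     square_mat A \<and> mat_adjoint A = A \<and>
     (\<forall>v \<in> carrier_vec (dim_row A). 0 \<le> (A *\<^sub>v v) \<bullet>c v)"

definition euclid_norm :: "complex vec \<Rightarrow> real" where
  "euclid_norm v = L2_set (\<lambda>i. cmod (v $ i)) {..<dim_vec v}"

text \<open>The operator norm induced by the Euclidean norm. The set is nonempty because the unit
  ball contains the zero vector, and it is bounded, so \<open>SUP\<close> is a genuine supremum.\<close>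

definition spectral_norm :: "complex mat \<Rightarrow> real" where
  "spectral_norm A =
     (SUP v \<in> {v \<in> carrier_vec (dim_col A). euclid_norm v \<le> 1}. euclid_norm (A *\<^sub>v v))"

definition mat_trace :: "complex mat \<Rightarrow> complex" where
  "mat_trace A = (\<Sum>i<dim_row A. A $$ (i, i))"

text \<open>The diagonal of a Hermitian matrix is real, so \<^const>\<open>Re\<close> loses nothing.\<close>

definition diag_entry :: "complex mat \<Rightarrow> nat \<Rightarrow> real" where
  "diag_entry A i = Re (A $$ (i, i))"

text \<open>The exponential integral \<open>E\<^sub>1\<close>; the integrand is integrable exactly for \<open>x > 0\<close>,
  the only arguments at which it is used.\<close>

definition E1 :: "real \<Rightarrow> real" where
  "E1 x = integral {1..} (\<lambda>t. exp (- t * x) / t)"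

definition G_DL :: "real \<Rightarrow> real \<Rightarrow> real \<Rightarrow> complex mat \<Rightarrow> real" where
  "G_DL kappa_t sigma2 p R =
     (\<Sum>i<dim_row R.
        1 / kappa_t *
        (1 - sigma2 / (p * kappa_t * diag_entry R i)
             * exp (sigma2 / (p * kappa_t * diag_entry R i))
             * E1 (sigma2 / (p * kappa_t * diag_entry R i))))"

definition C_DL_upper ::
    "real \<Rightarrow> real \<Rightarrow> real \<Rightarrow> real \<Rightarrow> real \<Rightarrow> real \<Rightarrow> complex mat \<Rightarrow> real" where
  "C_DL_upper T_data T_coher kappa_t kappa_r sigma2 p R =
     T_data / T_coher *
     log 2 (1 + G_DL kappa_t sigma2 p R / (1 + kappa_r * G_DL kappa_t sigma2 p R))"

end

theory Submission
  imports Defs "HOL-Real_Asymp.Real_Asymp"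
begin

text \<open>Write \<open>\<phi>(x) = x e\<^sup>x E\<^sub>1(x)\<close>, so that \<open>\<kappa>\<^sub>t G\<close> is the sum of \<open>1 - \<phi>(c / r\<^sub>i\<^sub>i)\<close>. An elementary
  function whose derivative lies below \<open>E\<^sub>1' (x) = - e\<^sup>-\<^sup>x / x\<close> and which vanishes at infinity
  dominates \<open>E\<^sub>1\<close>. In this way \<open>0 \<le> \<phi>(x) \<le> x ln (1 + 1 / x)\<close>, hence \<open>\<phi>(x) \<rightarrow> 0\<close> as \<open>x \<rightarrow> 0\<close>, which gives
  the limit in the transmit power; and \<open>\<phi>(x) \<le> (x + 1) / (x + 2)\<close>, hence
  \<open>1 - \<phi>(c / r) \<ge> r / (c + 2 r)\<close>. Since each \<open>r\<^sub>i\<^sub>i\<close> is at most the spectral norm \<open>\<le> M\<close>, the sum is at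
  least \<open>tr R / (c + 2 M)\<close>, which grows linearly in \<open>N\<close>; so \<open>G \<rightarrow> \<infinity>\<close>.\<close>

section \<open>Elementary bounds for the exponential integral\<close>

lemma E1_nonneg: "0 \<le> E1 x"
proof (cases "(\<lambda>t. exp (- t * x) / t) integrable_on {1..}")
  case True
  then show ?thesis
    unfolding E1_def by (rule integral_nonneg) auto
next
  \<comment> \<open>\<open>integral\<close> has the default value 0 on non-integrable functions, so
    the sign holds at every real \<open>x\<close>.\<close>
  case False
  then show ?thesis
    unfolding E1_def by (simp add: not_integrable_integral)
qed

text \<open>Substituting \<open>s = t * x\<close> turns \<open>E1 x\<close> into the integral of
  \<open>exp (- s) / s\<close> over \<open>s \<ge> x\<close>, while \<open>- g'\<close> integrates
  to \<open>g x\<close> there because \<open>g\<close> vanishes at infinity. Comparing the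
  integrands gives the bound.\<close>

lemma E1_le:
  fixes g g' :: "real \<Rightarrow> real"
  assumes x: "0 < x"
    and deriv: "\<And>y. x \<le> y \<Longrightarrow> (g has_real_derivative g' y) (at y)"
    and bound: "\<And>y. x \<le> y \<Longrightarrow> exp (- y) / y \<le> - g' y"
    and lim: "(g \<longlongrightarrow> 0) at_top"
    and meas [measurable]: "g' \<in> borel_measurable borel"
  shows "E1 x \<le> g x"
proof -
  \<comment> \<open>The substitution is made on the side of \<open>g\<close>: \<open>f\<close> is
    the derivative of \<open>- g (t * x)\<close> in \<open>t\<close>, so the integrand in
    \<open>E1\<close> keeps its form.\<close>
  define f where "f = (\<lambda>t. - (x * g' (t * x)))"
  have le: "exp (- t * x) / t \<le> f t" if "1 \<le> t" for t
  proof -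
    have "x * (exp (- (t * x)) / (t * x)) \<le> x * - g' (t * x)"
      using that x by (intro mult_left_mono bound) auto
    then show ?thesis using x that by (simp add: f_def)
  qed
  have nonneg: "0 \<le> f t" if "1 \<le> t" for t
    using le[OF that] that by (meson divide_nonneg_nonneg exp_ge_zero order_trans zero_le_one)
  have D: "((\<lambda>t. - g (t * x)) has_real_derivative f t) (at t)" if "1 \<le> t" for t
  proof -
    have "((\<lambda>t. g (t * x)) has_real_derivative g' (t * x) * x) (at t)"
      using x that by (intro DERIV_chain2[where f = g] deriv) (auto intro!: derivative_eq_intros)
    then show ?thesis
      unfolding f_def by (auto intro!: derivative_eq_intros)
  qed
  have lim': "((\<lambda>t. - g (t * x)) \<longlongrightarrow> 0) at_top"
  proof -
    have "filterlim (\<lambda>t. t * x) at_top at_top"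
      using x by real_asymp
    from tendsto_minus[OF filterlim_compose[OF lim this]] show ?thesis by simp
  qed
  have fm [measurable]: "f \<in> borel_measurable borel"
    unfolding f_def by measurable
  have nn: "(\<integral>\<^sup>+t. ennreal (f t) * indicator {1..} t \<partial>lborel) = g x"
    using nn_integral_FTC_atLeast[OF fm D nonneg lim'] by simp
  \<comment> \<open>\<open>- g (t * x)\<close> increases to 0, so it is at most 0 at
    \<open>t = 1\<close>. The sign is needed to pass from \<open>ennreal\<close> to reals, and for
    the default value 0 of \<open>E1 x\<close> in the last case.\<close>
  have gx: "0 \<le> g x"
  proof -
    have "- g (1 * x) \<le> 0"
    proof (rule tendsto_lowerbound[OF lim'])
      show "\<forall>\<^sub>F t in at_top. - g (1 * x) \<le> - g (t * x)"
        using eventually_ge_at_top[of 1]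
      proof eventually_elim
        case (elim t)
        show ?case
          by (rule DERIV_nonneg_imp_nondecreasing[OF elim]) (use D nonneg in blast)
      qed
    qed simp
    then show ?thesis by simp
  qed
  have hi: "(f has_integral g x) {1..}"
  proof -
    have "((\<lambda>t. indicator {1..} t * f t) has_integral g x) UNIV"
    proof (rule nn_integral_has_integral)
      show "(\<integral>\<^sup>+t. ennreal (indicator {1..} t * f t) \<partial>lborel) = ennreal (g x)"
        unfolding nn[symmetric] by (intro nn_integral_cong) (auto split: split_indicator)
    qed (use nonneg gx in \<open>auto split: split_indicator\<close>)
    also have "(\<lambda>t. indicator {1..} t * f t) = (\<lambda>t. if t \<in> {1..} then f t else 0)"
      by (auto simp: fun_eq_iff)
    finally show ?thesis by (simp only: has_integral_restrict_UNIV)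
  qed
  show ?thesis
  proof (cases "(\<lambda>t. exp (- t * x) / t) integrable_on {1..}")
    case True
    then have "((\<lambda>t. exp (- t * x) / t) has_integral E1 x) {1..}"
      unfolding E1_def by (rule integrable_integral)
    then show ?thesis
      using hi by (rule has_integral_le) (use le in auto)
  next
    case False
    then show ?thesis
      using gx unfolding E1_def by (simp add: not_integrable_integral)
  qed
qed

text \<open>\<open>E1\<close> has a logarithmic singularity at 0, and this bound is equally mild, so
  a factor \<open>x\<close> removes it.\<close>

lemma E1_le_ln:
  assumes "0 < x"
  shows "E1 x \<le> exp (- x) * ln (1 + 1 / x)"
proof (rule E1_le[OF assms, where g' = "\<lambda>y. - exp (- y) * (ln (1 + 1 / y) + 1 / (y * (y + 1)))"])
  fix y assume "x \<le> y"
  with assms have y: "0 < y" by simp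
  have "1 + 1 / y > 0" using y by (simp add: add_pos_pos)
  then show "((\<lambda>y. exp (- y) * ln (1 + 1 / y)) has_real_derivative
      - exp (- y) * (ln (1 + 1 / y) + 1 / (y * (y + 1)))) (at y)"
    using y by (auto intro!: derivative_eq_intros)
      (simp add: add_nonneg_eq_0_iff divide_simps, simp add: algebra_simps power2_eq_square)
  \<comment> \<open>The derivative condition amounts to
    \<open>1 / (y + 1) \<le> ln (1 + 1 / y)\<close>, which is \<open>ln z \<le> z - 1\<close> at
    \<open>z = y / (y + 1)\<close>.\<close>
  have "ln (y / (y + 1)) \<le> y / (y + 1) - 1"
    using y by (intro ln_le_minus_one) simp
  moreover have "y / (y + 1) = inverse (1 + 1 / y)"
    using y by (simp add: field_simps)
  then have "ln (y / (y + 1)) = - ln (1 + 1 / y)"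
    by (simp add: ln_inverse)
  moreover have "y / (y + 1) - 1 = 1 / (y * (y + 1)) - 1 / y"
    using y by (simp add: divide_simps)
  ultimately have "1 / y \<le> ln (1 + 1 / y) + 1 / (y * (y + 1))"
    by linarith
  then have "exp (- y) * (1 / y) \<le> exp (- y) * (ln (1 + 1 / y) + 1 / (y * (y + 1)))"
    by (intro mult_left_mono) auto
  then show "exp (- y) / y \<le> - (- exp (- y) * (ln (1 + 1 / y) + 1 / (y * (y + 1))))"
    by simp
next
  show "((\<lambda>y::real. exp (- y) * ln (1 + 1 / y)) \<longlongrightarrow> 0) at_top"
    by real_asymp
qed measurable

text \<open>The fraction is the third convergent of
  \<open>1 / (x + 1 / (1 + 1 / (x + 2 / (1 + ...))))\<close>, the continued fraction of
  \<open>exp x * E1 x\<close>. The first convergent \<open>1 / x\<close> would only give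
  \<open>1 - x * exp x * E1 x \<ge> 0\<close>, too weak to make a sum diverge.\<close>

lemma E1_le_rational:
  assumes "0 < x"
  shows "E1 x \<le> exp (- x) * ((x + 1) / (x * (x + 2)))"
proof (rule E1_le[OF assms, where g' = "\<lambda>y. - exp (- y) *
    ((y + 1) / (y * (y + 2)) + (y\<^sup>2 + 2 * y + 2) / (y * (y + 2))\<^sup>2)"])
  fix y assume "x \<le> y"
  with assms have y: "0 < y" by simp
  show "((\<lambda>y. exp (- y) * ((y + 1) / (y * (y + 2)))) has_real_derivative
      - exp (- y) * ((y + 1) / (y * (y + 2)) + (y\<^sup>2 + 2 * y + 2) / (y * (y + 2))\<^sup>2)) (at y)"
    using y by (auto intro!: derivative_eq_intros simp: divide_simps)
      (simp add: algebra_simps power2_eq_square)?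
  \<comment> \<open>The slack in the derivative condition, apart from the factor
    \<open>exp (- y)\<close>, is computed exactly and is visibly positive.\<close>
  have "(y + 1) / (y * (y + 2)) + (y\<^sup>2 + 2 * y + 2) / (y * (y + 2))\<^sup>2 - 1 / y
      = 2 / (y * (y + 2))\<^sup>2"
    using y by (simp add: divide_simps) (simp add: algebra_simps power2_eq_square)
  moreover have "0 \<le> 2 / (y * (y + 2))\<^sup>2" by simp
  ultimately have "1 / y \<le> (y + 1) / (y * (y + 2)) + (y\<^sup>2 + 2 * y + 2) / (y * (y + 2))\<^sup>2"
    by linarith
  then have "exp (- y) * (1 / y) \<le>
      exp (- y) * ((y + 1) / (y * (y + 2)) + (y\<^sup>2 + 2 * y + 2) / (y * (y + 2))\<^sup>2)"
    by (intro mult_left_mono) auto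
  then show "exp (- y) / y \<le>
      - (- exp (- y) * ((y + 1) / (y * (y + 2)) + (y\<^sup>2 + 2 * y + 2) / (y * (y + 2))\<^sup>2))"
    by simp
next
  show "((\<lambda>y::real. exp (- y) * ((y + 1) / (y * (y + 2)))) \<longlongrightarrow> 0) at_top"
    by real_asymp
qed measurable

lemma x_exp_E1_tendsto_0: "((\<lambda>x. x * exp x * E1 x) \<longlongrightarrow> 0) (at_right 0)"
proof (rule tendsto_sandwich)
  show "\<forall>\<^sub>F x in at_right 0. 0 \<le> x * exp x * E1 x"
    by (auto simp: eventually_at_right_less E1_nonneg intro!: eventually_mono[OF eventually_at_right_less])
  show "\<forall>\<^sub>F x in at_right 0. x * exp x * E1 x \<le> x * ln (1 + 1 / x)"
    using eventually_at_right_less[of "0::real"]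
  proof eventually_elim
    case (elim x)
    have "x * exp x * E1 x \<le> x * exp x * (exp (- x) * ln (1 + 1 / x))"
      using elim by (intro mult_left_mono E1_le_ln) auto
    also have "\<dots> = x * ln (1 + 1 / x)"
      by (simp add: exp_minus)
    finally show ?case .
  qed
  show "((\<lambda>x::real. x * ln (1 + 1 / x)) \<longlongrightarrow> 0) (at_right 0)"
    by real_asymp
qed simp

lemma one_minus_x_exp_E1_ge:
  assumes "0 < x"
  shows "1 / (x + 2) \<le> 1 - x * exp x * E1 x"
proof -
  have "x * exp x * E1 x \<le> x * exp x * (exp (- x) * ((x + 1) / (x * (x + 2))))"
    using assms by (intro mult_left_mono E1_le_rational) auto
  also have "\<dots> = (x + 1) / (x + 2)"
    using assms by (simp add: exp_minus)
  also have "\<dots> = 1 - 1 / (x + 2)"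
    using assms by (simp add: field_simps)
  finally show ?thesis by simp
qed

section \<open>Diagonal entries and the spectral norm\<close>

lemma bdd_above_euclid_norm_image:
  "bdd_above ((\<lambda>v. euclid_norm (A *\<^sub>v v)) ` {v \<in> carrier_vec (dim_col A). euclid_norm v \<le> 1})"
proof (rule bdd_aboveI2)
  fix v assume "v \<in> {v \<in> carrier_vec (dim_col A). euclid_norm v \<le> 1}"
  then have v: "dim_vec v = dim_col A" and n: "euclid_norm v \<le> 1" by auto
  \<comment> \<open>Coordinates of a vector in the unit ball have modulus at most 1, so the sum of
    the moduli of all matrix entries is a bound. Any finite bound suffices to make
    \<open>SUP\<close> an upper bound of its set.\<close>
  have c: "cmod (v $ j) \<le> 1" if "j < dim_col A" for j
  proof -
    have "cmod (v $ j) \<le> euclid_norm v"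
      unfolding euclid_norm_def using that v by (intro member_le_L2_set) auto
    with n show ?thesis by simp
  qed
  have "euclid_norm (A *\<^sub>v v) \<le> (\<Sum>i<dim_row A. cmod ((A *\<^sub>v v) $ i))"
    unfolding euclid_norm_def dim_mult_mat_vec by (rule L2_set_le_sum) simp
  also have "\<dots> \<le> (\<Sum>i<dim_row A. \<Sum>j<dim_col A. cmod (A $$ (i, j)))"
  proof (rule sum_mono)
    fix i assume i: "i \<in> {..<dim_row A}"
    have "(A *\<^sub>v v) $ i = (\<Sum>j<dim_col A. A $$ (i, j) * v $ j)"
      using i v by (simp add: scalar_prod_def atLeast0LessThan)
    also have "cmod \<dots> \<le> (\<Sum>j<dim_col A. cmod (A $$ (i, j) * v $ j))"
      by (rule norm_sum)
    also have "\<dots> \<le> (\<Sum>j<dim_col A. cmod (A $$ (i, j)))"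
      using c by (intro sum_mono) (simp add: norm_mult mult_left_le)
    finally show "cmod ((A *\<^sub>v v) $ i) \<le> (\<Sum>j<dim_col A. cmod (A $$ (i, j)))" .
  qed
  finally show "euclid_norm (A *\<^sub>v v) \<le> (\<Sum>i<dim_row A. \<Sum>j<dim_col A. cmod (A $$ (i, j)))" .
qed

lemma euclid_norm_unit_vec:
  assumes "i < n"
  shows "euclid_norm (unit_vec n i) = 1"
proof -
  have "(\<Sum>j<n. (cmod (unit_vec n i $ j))\<^sup>2) = (\<Sum>j<n. if j = i then 1 else 0)"
    using assms by (intro sum.cong) (auto simp: unit_vec_def)
  then show ?thesis
    using assms by (simp add: euclid_norm_def L2_set_def)
qed

text \<open>Testing the norm on the \<open>i\<close>-th unit vector: the diagonal entry is one
  coordinate of the image, and a coordinate is bounded by the Euclidean norm.\<close>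

lemma diag_entry_le_spectral_norm:
  assumes "i < dim_row A" "i < dim_col A"
  shows "diag_entry A i \<le> spectral_norm A"
proof -
  let ?e = "unit_vec (dim_col A) i :: complex vec"
  have "(A *\<^sub>v ?e) $ i = A $$ (i, i)"
    using assms by simp
  then have "diag_entry A i \<le> cmod ((A *\<^sub>v ?e) $ i)"
    by (simp add: diag_entry_def complex_Re_le_cmod)
  also have "\<dots> \<le> euclid_norm (A *\<^sub>v ?e)"
    unfolding euclid_norm_def using assms by (intro member_le_L2_set) auto
  also have "\<dots> \<le> spectral_norm A"
    unfolding spectral_norm_def using assms
    by (intro cSUP_upper bdd_above_euclid_norm_image) (auto simp: euclid_norm_unit_vec)
  finally show ?thesis .
qed

section \<open>Asymptotics of \<open>G_DL\<close>\<close>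

lemma Re_mat_trace: "Re (mat_trace A) = (\<Sum>i<dim_row A. diag_entry A i)"
  by (simp add: mat_trace_def diag_entry_def)

text \<open>For a fixed matrix the sum is finite, and each argument of \<open>E1\<close> tends to 0
  through positive values, so every summand tends to \<open>1 / kappa_t\<close>.\<close>

lemma G_DL_tendsto_power:
  assumes "\<And>i. i < dim_row A \<Longrightarrow> 0 < diag_entry A i" "0 < kappa_t" "0 < sigma2"
  shows "((\<lambda>p. G_DL kappa_t sigma2 p A) \<longlongrightarrow> real (dim_row A) / kappa_t) at_top"
proof -
  have "((\<lambda>p. G_DL kappa_t sigma2 p A) \<longlongrightarrow> (\<Sum>i<dim_row A. 1 / kappa_t * (1 - 0))) at_top"
    unfolding G_DL_def
  proof (intro tendsto_intros)
    fix i assume "i \<in> {..<dim_row A}"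
    then have "0 < diag_entry A i" using assms by simp
    then have "filterlim (\<lambda>p. sigma2 / (p * kappa_t * diag_entry A i)) (at_right 0) at_top"
      using assms by real_asymp
    from filterlim_compose[OF x_exp_E1_tendsto_0 this]
    show "((\<lambda>p. sigma2 / (p * kappa_t * diag_entry A i)
        * exp (sigma2 / (p * kappa_t * diag_entry A i))
        * E1 (sigma2 / (p * kappa_t * diag_entry A i))) \<longlongrightarrow> 0) at_top" .
  qed
  then show ?thesis by simp
qed

lemma G_DL_ge_trace:
  assumes diag: "\<And>i. i < dim_row A \<Longrightarrow> 0 < diag_entry A i"
    and le: "\<And>i. i < dim_row A \<Longrightarrow> diag_entry A i \<le> M"
    and pos: "0 < kappa_t" "0 < sigma2" "0 < p" "0 \<le> M"
  shows "Re (mat_trace A) / (kappa_t * (sigma2 / (p * kappa_t) + 2 * M)) \<le> G_DL kappa_t sigma2 p A"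
proof -
  define c where "c = sigma2 / (p * kappa_t)"
  have c: "0 < c" using pos by (simp add: c_def)
  have "Re (mat_trace A) / (kappa_t * (c + 2 * M))
      = (\<Sum>i<dim_row A. 1 / kappa_t * (diag_entry A i / (c + 2 * M)))"
    by (simp add: Re_mat_trace sum_divide_distrib)
  also have "\<dots> \<le> G_DL kappa_t sigma2 p A"
    unfolding G_DL_def
  proof (intro sum_mono mult_left_mono)
    fix i assume "i \<in> {..<dim_row A}"
    then have r: "0 < diag_entry A i" "diag_entry A i \<le> M" using diag le by auto
    let ?x = "sigma2 / (p * kappa_t * diag_entry A i)"
    have x: "?x = c / diag_entry A i" by (simp add: c_def)
    \<comment> \<open>Replacing the entry by \<open>M\<close> in the denominator makes the bound
      linear in the entry, so that the terms add up to the trace.\<close>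
    have "diag_entry A i / (c + 2 * M) \<le> diag_entry A i / (c + 2 * diag_entry A i)"
      using r c by (intro divide_left_mono) auto
    also have "\<dots> = 1 / (?x + 2)"
      using r c unfolding x by (simp add: field_simps)
    also have "\<dots> \<le> 1 - ?x * exp ?x * E1 ?x"
      using r pos by (intro one_minus_x_exp_E1_ge) simp
    finally show "diag_entry A i / (c + 2 * M) \<le> 1 - ?x * exp ?x * E1 ?x" .
  qed (use pos in simp)
  finally show ?thesis by (simp add: c_def)
qed

section \<open>The two limits of the capacity bound\<close>

theorem corollary2:
  fixes R :: "nat \<Rightarrow> complex mat"
    and T_data T_coher kappa_t kappa_r sigma2 :: real
  assumes dim: "\<And>N. N \<ge> 1 \<Longrightarrow> R N \<in> carrier_mat N N"
    and psd: "\<And>N. N \<ge> 1 \<Longrightarrow> pos_semidef (R N)"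
    and diag_pos: "\<And>N i. N \<ge> 1 \<Longrightarrow> i < N \<Longrightarrow> 0 < diag_entry (R N) i"
    and norm_bounded: "(\<lambda>N. spectral_norm (R N)) \<in> O(\<lambda>_. 1)"
    and trace_liminf: "0 < liminf (\<lambda>N. ereal (1 / real N * Re (mat_trace (R N))))"
    and trace_limsup: "limsup (\<lambda>N. ereal (1 / real N * Re (mat_trace (R N)))) < \<infinity>"
    and T_coher: "0 < T_coher"
    and T_data: "0 \<le> T_data" "T_data \<le> T_coher"
    and kappa_t: "0 < kappa_t"
    and kappa_r: "0 < kappa_r"
    and sigma2: "0 < sigma2"
  shows "(\<forall>N \<ge> 1.
            ((\<lambda>p. C_DL_upper T_data T_coher kappa_t kappa_r sigma2 p (R N)) \<longlongrightarrow>
              T_data / T_coher * log 2 (1 + real N / (kappa_t + kappa_r * real N))) at_top) \<and>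
         (\<forall>p > 0.
            (\<lambda>N. C_DL_upper T_data T_coher kappa_t kappa_r sigma2 p (R N)) \<longlonglongrightarrow>
              T_data / T_coher * log 2 (1 + 1 / kappa_r))"
proof (intro conjI allI impI)
  fix N :: nat assume N: "1 \<le> N"
  have dimN: "dim_row (R N) = N" using dim[OF N] by simp
  have "((\<lambda>p. G_DL kappa_t sigma2 p (R N)) \<longlongrightarrow> real N / kappa_t) at_top"
    using G_DL_tendsto_power[of "R N" kappa_t sigma2] diag_pos[OF N] kappa_t sigma2 dimN by simp
  \<comment> \<open>This and the next fact are the side conditions for continuity of the quotient
    and of the logarithm at the limit.\<close>
  moreover have "1 + kappa_r * (real N / kappa_t) > 0"
    using kappa_r kappa_t by (simp add: add_pos_nonneg)
  moreover have "1 + real N / kappa_t / (1 + kappa_r * (real N / kappa_t)) > 0"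
    using kappa_r kappa_t by (simp add: add_pos_nonneg)
  ultimately have "((\<lambda>p. C_DL_upper T_data T_coher kappa_t kappa_r sigma2 p (R N)) \<longlongrightarrow>
      T_data / T_coher * log 2 (1 + real N / kappa_t / (1 + kappa_r * (real N / kappa_t)))) at_top"
    unfolding C_DL_upper_def by (intro tendsto_intros) auto
  also have "real N / kappa_t / (1 + kappa_r * (real N / kappa_t)) = real N / (kappa_t + kappa_r * real N)"
    using kappa_t by (simp add: divide_simps)
  finally show "((\<lambda>p. C_DL_upper T_data T_coher kappa_t kappa_r sigma2 p (R N)) \<longlongrightarrow>
      T_data / T_coher * log 2 (1 + real N / (kappa_t + kappa_r * real N))) at_top" .
next
  fix p :: real assume p: "0 < p"
  from norm_bounded obtain M where M: "0 < M"
    and ev_norm: "\<forall>\<^sub>F N in sequentially. norm (spectral_norm (R N)) \<le> M * norm (1::real)"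
    by (elim landau_o.bigE)
  \<comment> \<open>A real \<open>t\<close> strictly between 0 and the lower limit: from some
    \<open>N\<close> on, the trace exceeds \<open>N * t\<close>.\<close>
  obtain t where "0 < ereal t" and t_less: "ereal t < liminf (\<lambda>N. ereal (1 / real N * Re (mat_trace (R N))))"
    using ereal_dense2[OF trace_liminf] by (auto simp: zero_ereal_def)
  then have t: "0 < t" by simp
  have ev_trace: "\<forall>\<^sub>F N in sequentially. ereal t < ereal (1 / real N * Re (mat_trace (R N)))"
    using less_LiminfD[OF t_less] .
  \<comment> \<open>\<open>K\<close> is the denominator in \<open>G_DL_ge_trace\<close>. It does not
    depend on \<open>N\<close>, so \<open>G_DL\<close> is eventually at least
    \<open>N * t / K\<close>.\<close>
  define K where "K = kappa_t * (sigma2 / (p * kappa_t) + 2 * M)"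
  have K: "0 < K"
    using kappa_t sigma2 p M by (simp add: K_def add_pos_pos)
  have "filterlim (\<lambda>N. G_DL kappa_t sigma2 p (R N)) at_top sequentially"
  proof (rule filterlim_at_top_mono)
    show "filterlim (\<lambda>N. real N * t / K) at_top sequentially"
      using t K by real_asymp
    show "\<forall>\<^sub>F N in sequentially. real N * t / K \<le> G_DL kappa_t sigma2 p (R N)"
      using ev_norm ev_trace eventually_ge_at_top[of 1]
    proof eventually_elim
      case (elim N)
      have d: "dim_row (R N) = N" "dim_col (R N) = N" using dim[OF elim(3)] by auto
      have le: "diag_entry (R N) i \<le> M" if "i < N" for i
        using diag_entry_le_spectral_norm[of i "R N"] that d elim(1) by simp
      have "real N * t \<le> Re (mat_trace (R N))"
        using elim by (simp add: field_simps)
      then have "real N * t / K \<le> Re (mat_trace (R N)) / K"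
        using K by (intro divide_right_mono) auto
      also have "\<dots> \<le> G_DL kappa_t sigma2 p (R N)"
        unfolding K_def using diag_pos[OF elim(3)] le d kappa_t sigma2 p M
        by (intro G_DL_ge_trace) auto
      finally show ?case .
    qed
  qed
  \<comment> \<open>The receiver impairment saturates the ratio, so only the divergence of
    \<open>G_DL\<close> matters and not its rate.\<close>
  moreover have "((\<lambda>G. G / (1 + kappa_r * G)) \<longlongrightarrow> 1 / kappa_r) at_top"
    using kappa_r unfolding inverse_eq_divide[symmetric] by real_asymp
  ultimately have lim: "(\<lambda>N. G_DL kappa_t sigma2 p (R N) / (1 + kappa_r * G_DL kappa_t sigma2 p (R N)))
      \<longlonglongrightarrow> 1 / kappa_r"
    by (rule filterlim_compose[rotated])
  have "1 + 1 / kappa_r > 0"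
    using kappa_r by (simp add: add_pos_pos)
  then show "(\<lambda>N. C_DL_upper T_data T_coher kappa_t kappa_r sigma2 p (R N)) \<longlonglongrightarrow>
      T_data / T_coher * log 2 (1 + 1 / kappa_r)"
    unfolding C_DL_upper_def
    by (intro tendsto_mult[OF tendsto_const] tendsto_log tendsto_add[OF tendsto_const lim]) auto
qed

end
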